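(* Let $c>0$, $\beta\in[0,1)$ and $n\in\mathbb{N}$ with $n>3c$. Then for every $f\in C_B[0,\infty)$ and every $x\ge 0$, $$|\mathcal{D}_{n,c}^{\beta}(f,x)-f(x)|\le \omega\big(f,\mu_{1,n,c}^{\beta}(x)\big)+M\,\omega_2\Big(f,\sqrt{\big(\mu_{1,n,c}^{\beta}(x)\big)^2+\mu_{2,n,c}^{\beta}(x)}\Big),$$ where $M$ is a positive absolute constant.
   Context: For $\beta\in[0,1)$, $x\ge 0$, $n\in\mathbb{N}$ and integers $v\ge0$ let $\omega_\beta(v,nx)=nx(nx+v\beta)^{v-1}\frac{e^{-(nx+v\beta)}}{v!}$. For $c>0$, integers $v\ge1$ and $t\ge0$ let $p_{n,v-1,c}(t)=c\,\frac{\Gamma(n/c+v-1)}{\Gamma(v)\Gamma(n/c)}\cdot\frac{(ct)^{v-1}}{(1+ct)^{n/c+v-1}}$. The modified Jain-Baskakov operators are $$\mathcal{D}_{n,c}^{\beta}(f,x)=\frac{n-c}{c}\sum_{v=1}^{\infty}\omega_\beta(v,nx)\int_0^\infty p_{n,v-1,c}(t)f(t)\,dt+e^{-nx}f(0).$$ $\mu_{1,n,c}^{\beta}(x)=\mathcal{D}_{n,c}^{\beta}(t-x,x)=\frac{x(n\beta+2c(1-\beta))}{(n-2c)(1-\beta)}$ and $\mu_{2,n,c}^{\beta}(x)=\mathcal{D}_{n,c}^{\beta}((t-x)^2,x)$ (operator applied to $t\mapsto (t-x)^k$, evaluated at $x$). $C_B[0,\infty)$ is the space of bounded continuous functions on $[0,\infty)$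 with the sup norm. $\omega(f,\delta)=\sup\{|f(t)-f(x)|: x,t\ge0,\ |t-x|\le\delta\}$ is the modulus of continuity and $\omega_2(f,\delta)=\sup_{0<h\le\delta}\sup_{x\ge0}|f(x+2h)-2f(x+h)+f(x)|$ is the second order modulus of smoothness. *)

theory Defs
  imports "HOL-Analysis.Analysis"
begin

definition omega_beta :: "real \<Rightarrow> nat \<Rightarrow> real \<Rightarrow> real" where
  "omega_beta \<beta> v y = y * (y + real v * \<beta>) ^ (v - 1) * exp (- (y + real v * \<beta>)) / fact v"

definition p_basis :: "nat \<Rightarrow> nat \<Rightarrow> real \<Rightarrow> real \<Rightarrow> real" where
  "p_basis n v c t = c * Gamma (real n / c + real v - 1) / (Gamma (real v) * Gamma (real n / c))
     * (c * t) ^ (v - 1) / (1 + c * t) powr (real n / c + real v - 1)"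

definition JB_op :: "nat \<Rightarrow> real \<Rightarrow> real \<Rightarrow> (real \<Rightarrow> real) \<Rightarrow> real \<Rightarrow> real" where
  "JB_op n c \<beta> f x =
     (real n - c) / c *
       (\<Sum>k. omega_beta \<beta> (Suc k) (real n * x) *
              (LINT t:{0..}|lborel. p_basis n (Suc k) c t * f t))
     + exp (- (real n * x)) * f 0"

definition mu1 :: "nat \<Rightarrow> real \<Rightarrow> real \<Rightarrow> real \<Rightarrow> real" where
  "mu1 n c \<beta> x = x * (real n * \<beta> + 2 * c * (1 - \<beta>)) / ((real n - 2 * c) * (1 - \<beta>))"

definition mu2 :: "nat \<Rightarrow> real \<Rightarrow> real \<Rightarrow> real \<Rightarrow> real" where
  "mu2 n c \<beta> x = JB_op n c \<beta> (\<lambda>t. (t - x) ^ 2) x"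

definition CB :: "(real \<Rightarrow> real) set" where
  "CB = {f. continuous_on {0..} f \<and> bounded (f ` {0..})}"

text \<open>Suprema of nonnegative quantities; 0 is inserted so that the sup over an empty
  index set is 0 (standard convention), which does not change nonempty suprema.\<close>
definition modcont :: "(real \<Rightarrow> real) \<Rightarrow> real \<Rightarrow> real" where
  "modcont f \<delta> = Sup (insert 0 {\<bar>f t - f x\<bar> | x t. x \<ge> 0 \<and> t \<ge> 0 \<and> \<bar>t - x\<bar> \<le> \<delta>})"

definition modsmooth2 :: "(real \<Rightarrow> real) \<Rightarrow> real \<Rightarrow> real" where
  "modsmooth2 f \<delta> = Sup (insert 0 {\<bar>f (x + 2 * h) - 2 * f (x + h) + f x\<bar> | x h. 0 < h \<and> h \<le> \<delta> \<and> x \<ge> 0})"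

end

theory Submission
  imports Defs "HOL-Real_Asymp.Real_Asymp"
begin

text \<open>
  The operator is positive and linear, preserves constants and sends the identity to
  \<open>a = x + \<mu>\<^sub>1\<close>. Split \<open>D f - f x\<close> as \<open>D (f - g) + (D g - g a) + (g a - f a) + (f a - f x)\<close> for a
  Steklov mean \<open>g\<close> of \<open>f\<close> with step of order \<open>\<delta> = sqrt (\<mu>\<^sub>1\<^sup>2 + \<mu>\<^sub>2)\<close>. With \<open>W = \<omega>\<^sub>2 (f, \<delta>)\<close>, the mean
  satisfies \<open>\<bar>f - g\<bar> \<le> W\<close> and \<open>\<bar>g''\<bar> \<le> 9 W / \<delta>\<^sup>2\<close>, and Taylor expansion of \<open>g\<close> at \<open>a\<close> bounds
  \<open>D g - g a\<close> by \<open>9/2 W\<close>, which gives \<open>M = 13/2\<close>.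

  The moments need \<open>\<Sum> \<omega>\<^sub>\<beta>(v, y) = 1\<close> and \<open>\<Sum> v \<omega>\<^sub>\<beta>(v, y) = y / (1 - \<beta>)\<close>. Both follow without Lagrange
  inversion from \<open>\<partial>/\<partial>y \<omega>\<^sub>\<beta>(v, y) = \<omega>\<^sub>\<beta>(v - 1, y + \<beta>) - \<omega>\<^sub>\<beta>(v, y)\<close>: the tails of the series satisfy a
  recursion that has an explicit geometrically decaying supersolution.
\<close>

section \<open>Generalised Poisson weights\<close>

text \<open>Integrating factor: the derivative of exp t * u t is exp t * (u' t + u t). This
  comparison principle carries every bound on the tails from index N to N + 1.\<close>

lemma nonneg_if_deriv_plus_self_nonneg:
  fixes u u' :: "real \<Rightarrow> real"
  assumes deriv: "\<And>t. 0 \<le> t \<Longrightarrow> (u has_real_derivative u' t) (at t)"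
    and nonneg: "\<And>t. 0 \<le> t \<Longrightarrow> 0 \<le> u' t + u t"
    and "0 \<le> u 0" "0 \<le> a"
  shows "0 \<le> u a"
proof -
  have "exp 0 * u 0 \<le> exp a * u a"
  proof (rule DERIV_nonneg_imp_nondecreasing[OF \<open>0 \<le> a\<close>, of "\<lambda>t. exp t * u t"])
    fix t :: real assume t: "0 \<le> t" "t \<le> a"
    have "((\<lambda>t. exp t * u t) has_real_derivative exp t * (u' t + u t)) (at t)"
      using deriv[OF t(1)] by (auto intro!: derivative_eq_intros simp: algebra_simps)
    with nonneg[OF t(1)] show "\<exists>y. ((\<lambda>t. exp t * u t) has_real_derivative y) (at t) \<and> 0 \<le> y"
      by (intro exI[of _ "exp t * (u' t + u t)"]) auto
  qed
  with assms(3) have "0 \<le> exp a * u a" by simp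
  then show ?thesis by (simp add: zero_le_mult_iff)
qed

text \<open>At \<open>v = 0\<close> the formula of \<^const>\<open>omega_beta\<close> has the junk value \<open>y * exp (- y)\<close>, because of truncated
  subtraction in the exponent \<open>v - 1\<close>; the intended weight is \<open>exp (- y)\<close>.\<close>

definition gen_poisson :: "real \<Rightarrow> nat \<Rightarrow> real \<Rightarrow> real" where
  "gen_poisson \<beta> k a = (if k = 0 then exp (- a) else omega_beta \<beta> k a)"

lemma gen_poisson_0 [simp]: "gen_poisson \<beta> 0 a = exp (- a)"
  by (simp add: gen_poisson_def)

lemma gen_poisson_Suc: "gen_poisson \<beta> (Suc k) a = omega_beta \<beta> (Suc k) a"
  by (simp add: gen_poisson_def)

lemma gen_poisson_Suc_at_0 [simp]: "gen_poisson \<beta> (Suc k) 0 = 0"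
  by (simp add: gen_poisson_def omega_beta_def)

lemma gen_poisson_nonneg: "0 \<le> \<beta> \<Longrightarrow> 0 \<le> a \<Longrightarrow> 0 \<le> gen_poisson \<beta> k a"
  by (simp add: gen_poisson_def omega_beta_def)

lemma deriv_gen_poisson_0:
  "(gen_poisson \<beta> 0 has_real_derivative - gen_poisson \<beta> 0 a) (at a)"
  unfolding gen_poisson_def by (auto intro!: derivative_eq_intros)

text \<open>Shifting the argument by \<beta> compensates the drop in index: (a + \<beta>) + k
  \<beta> = a + (k + 1) \<beta>, so the base of the power and the exponent stay the same. The case k
  = 0 is separate because the weight of index 0 has its own formula.\<close>

lemma deriv_gen_poisson_Suc:
  "(gen_poisson \<beta> (Suc k) has_real_derivative
     gen_poisson \<beta> k (a + \<beta>) - gen_poisson \<beta> (Suc k) a) (at a)"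
proof (cases k)
  case 0
  then show ?thesis
    unfolding gen_poisson_def omega_beta_def
    by (auto intro!: derivative_eq_intros simp: exp_diff exp_add exp_minus field_simps)
next
  case (Suc m)
  then have m: "m = k - Suc 0" by simp
  define b where "b = a + real (Suc k) * \<beta>"
  define E where "E = exp (- b)"
  have b': "a + \<beta> + real k * \<beta> = b"
    by (simp add: b_def algebra_simps)
  have "((\<lambda>a. a * (a + q) ^ k * exp (- (a + q))) has_real_derivative
     (b ^ k + a * (real k * b ^ m)) * E - a * b ^ k * E) (at a)" if "b = a + q" for q
    unfolding E_def that m by (auto intro!: derivative_eq_intros simp: algebra_simps)
  from DERIV_cdivide[OF this[OF b_def], of "fact (Suc k)"]
  have "(gen_poisson \<beta> (Suc k) has_real_derivative
     ((b ^ k + a * (real k * b ^ m)) * E - a * b ^ k * E) / fact (Suc k)) (at a)"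
    unfolding gen_poisson_def omega_beta_def by simp
  also have "((b ^ k + a * (real k * b ^ m)) * E - a * b ^ k * E) / fact (Suc k) =
      (b + a * real k) * b ^ m * E / fact (Suc k) - a * b ^ k * E / fact (Suc k)"
    using Suc by (simp add: algebra_simps add_divide_distrib diff_divide_distrib)
  \<comment> \<open>The product rule leaves a factor k + 1, which cancels against the
    factorial.\<close>
  also have "b + a * real k = real (Suc k) * (a + \<beta>)"
    by (simp add: b_def algebra_simps)
  also have "real (Suc k) * (a + \<beta>) * b ^ m * E / fact (Suc k) = (a + \<beta>) * b ^ m * E / fact k"
    by (simp add: mult.assoc del: of_nat_Suc)
  also have "\<dots> = gen_poisson \<beta> k (a + \<beta>)"
    unfolding gen_poisson_def omega_beta_def b' E_def using Suc by simp
  also have "a * b ^ k * E / fact (Suc k) = gen_poisson \<beta> (Suc k) a"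
    by (simp add: gen_poisson_def omega_beta_def E_def b_def)
  finally show ?thesis .
qed

text \<open>Written as the expected total minus a partial sum, because convergence to that total is
  what the decay of this remainder has to prove.\<close>

definition gen_poisson_tail :: "real \<Rightarrow> nat \<Rightarrow> real \<Rightarrow> real" where
  "gen_poisson_tail \<beta> N a = 1 - (\<Sum>k<N. gen_poisson \<beta> k a)"

definition gen_poisson_mean_tail :: "real \<Rightarrow> nat \<Rightarrow> real \<Rightarrow> real" where
  "gen_poisson_mean_tail \<beta> N a = a / (1 - \<beta>) - (\<Sum>k<N. real k * gen_poisson \<beta> k a)"

lemma gen_poisson_tail_at_0: "gen_poisson_tail \<beta> (Suc N) 0 = 0"
  unfolding gen_poisson_tail_def by (subst sum.lessThan_Suc_shift) simp

lemma gen_poisson_mean_tail_at_0: "gen_poisson_mean_tail \<beta> N 0 = 0"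
proof -
  have "real k * gen_poisson \<beta> k 0 = 0" for k by (cases k) auto
  then have "(\<Sum>k<N. real k * gen_poisson \<beta> k 0) = 0" by (rule sum.neutral[OF ballI])
  then show ?thesis unfolding gen_poisson_mean_tail_def by simp
qed

text \<open>Termwise differentiation; the two constants 1 cancel, so the total 1 is compatible with
  the recursion.\<close>

lemma deriv_gen_poisson_tail:
  "(gen_poisson_tail \<beta> (Suc N) has_real_derivative
     gen_poisson_tail \<beta> N (a + \<beta>) - gen_poisson_tail \<beta> (Suc N) a) (at a)"
  unfolding gen_poisson_tail_def sum.lessThan_Suc_shift
  by (auto intro!: derivative_eq_intros deriv_gen_poisson_Suc
      DERIV_cong[OF deriv_gen_poisson_0] simp del: gen_poisson_0 simp: sum_subtractf)

text \<open>Writing (k + 1) w = k w + w produces the additional ordinary tail. The mean a / (1 -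
  \<beta>) fits because 1 / (1 - \<beta>) = (a + \<beta>) / (1 - \<beta>) + 1 - a / (1 -
  \<beta>).\<close>

lemma deriv_gen_poisson_mean_tail:
  assumes "\<beta> < 1"
  shows "(gen_poisson_mean_tail \<beta> (Suc N) has_real_derivative
     gen_poisson_mean_tail \<beta> N (a + \<beta>) + gen_poisson_tail \<beta> N (a + \<beta>)
       - gen_poisson_mean_tail \<beta> (Suc N) a) (at a)"
proof -
  have "(gen_poisson_mean_tail \<beta> (Suc N) has_real_derivative
     1 / (1 - \<beta>) - (\<Sum>k<N. (gen_poisson \<beta> k (a + \<beta>) - gen_poisson \<beta> (Suc k) a) * real (Suc k))) (at a)"
    unfolding gen_poisson_mean_tail_def sum.lessThan_Suc_shift using assms
    by (auto intro!: derivative_eq_intros DERIV_cong[OF deriv_gen_poisson_Suc]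
      simp del: of_nat_Suc)
  also have "1 / (1 - \<beta>) - (\<Sum>k<N. (gen_poisson \<beta> k (a + \<beta>) - gen_poisson \<beta> (Suc k) a) * real (Suc k))
    = gen_poisson_mean_tail \<beta> N (a + \<beta>) + gen_poisson_tail \<beta> N (a + \<beta>)
       - gen_poisson_mean_tail \<beta> (Suc N) a"
    using assms
    unfolding gen_poisson_mean_tail_def gen_poisson_tail_def sum.lessThan_Suc_shift
    by (simp add: sum.distrib sum_subtractf algebra_simps) (simp add: divide_simps algebra_simps)
  finally show ?thesis .
qed

text \<open>The recursion turns u' + u into the previous tail at a + \<beta>, hence the induction
  over arbitrary a.\<close>

lemma gen_poisson_tail_nonneg:
  assumes "0 \<le> \<beta>" "0 \<le> a"
  shows "0 \<le> gen_poisson_tail \<beta> N a"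
  using assms(2)
proof (induction N arbitrary: a)
  case 0
  then show ?case by (simp add: gen_poisson_tail_def)
next
  case (Suc N)
  show ?case
    by (rule nonneg_if_deriv_plus_self_nonneg[OF deriv_gen_poisson_tail])
      (use Suc assms in \<open>auto simp: gen_poisson_tail_at_0\<close>)
qed

lemma gen_poisson_mean_tail_nonneg:
  assumes "0 \<le> \<beta>" "\<beta> < 1" "0 \<le> a"
  shows "0 \<le> gen_poisson_mean_tail \<beta> N a"
  using assms(3)
proof (induction N arbitrary: a)
  case 0
  then show ?case using assms by (simp add: gen_poisson_mean_tail_def)
next
  case (Suc N)
  show ?case
    by (rule nonneg_if_deriv_plus_self_nonneg[OF deriv_gen_poisson_mean_tail])
      (use Suc assms in \<open>auto simp: gen_poisson_mean_tail_at_0 intro!: add_nonneg_nonneg gen_poisson_tail_nonneg\<close>)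
qed

text \<open>The choice of \<open>\<rho>\<close> makes \<open>exp (\<theta> * a) * \<rho> ^ N\<close> a solution of the recursion
  \<open>u\<^sub>N' + u\<^sub>N = u\<^sub>N\<^sub>-\<^sub>1 (a + \<beta>)\<close> satisfied by the tails.\<close>

lemma gen_poisson_tail_le:
  assumes "0 \<le> \<beta>" "0 < \<theta>" "0 \<le> a" and \<rho>: "\<rho> = exp (\<theta> * \<beta>) / (1 + \<theta>)"
  shows "gen_poisson_tail \<beta> N a \<le> exp (\<theta> * a) * \<rho> ^ N"
  using assms(3)
proof (induction N arbitrary: a)
  case 0
  then show ?case using assms by (simp add: gen_poisson_tail_def)
next
  case (Suc N)
  have \<rho>': "(1 + \<theta>) * \<rho> = exp (\<theta> * \<beta>)" using assms by simp
  have "0 \<le> exp (\<theta> * a) * \<rho> ^ Suc N - gen_poisson_tail \<beta> (Suc N) a"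
  proof (rule nonneg_if_deriv_plus_self_nonneg[OF _ _ _ Suc.prems])
    fix t :: real assume t: "0 \<le> t"
    show "((\<lambda>a. exp (\<theta> * a) * \<rho> ^ Suc N - gen_poisson_tail \<beta> (Suc N) a) has_real_derivative
        \<theta> * exp (\<theta> * t) * \<rho> ^ Suc N
          - (gen_poisson_tail \<beta> N (t + \<beta>) - gen_poisson_tail \<beta> (Suc N) t)) (at t)"
      by (auto intro!: derivative_eq_intros DERIV_cong[OF deriv_gen_poisson_tail])
    have "exp (\<theta> * (t + \<beta>)) * \<rho> ^ N = exp (\<theta> * t) * \<rho> ^ N * ((1 + \<theta>) * \<rho>)"
      unfolding \<rho>' by (simp add: exp_add algebra_simps)
    also have "\<dots> = (1 + \<theta>) * exp (\<theta> * t) * \<rho> ^ Suc N"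
      by simp
    finally show "0 \<le> \<theta> * exp (\<theta> * t) * \<rho> ^ Suc N
          - (gen_poisson_tail \<beta> N (t + \<beta>) - gen_poisson_tail \<beta> (Suc N) t)
        + (exp (\<theta> * t) * \<rho> ^ Suc N - gen_poisson_tail \<beta> (Suc N) t)"
      using Suc.IH[of "t + \<beta>"] t assms(1) by (simp add: algebra_simps)
  next
    show "0 \<le> exp (\<theta> * 0) * \<rho> ^ Suc N - gen_poisson_tail \<beta> (Suc N) 0"
      using assms by (simp add: gen_poisson_tail_at_0)
  qed
  then show ?case by simp
qed

text \<open>The ordinary tail acts as a source that adds one multiple of the geometric bound per
  step, whence the summand \<open>real N\<close>. The constant 1 / (\<theta> (1 - \<beta>)) covers N
  = 0.\<close>

lemma gen_poisson_mean_tail_le: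
  assumes "0 \<le> \<beta>" "\<beta> < 1" "0 < \<theta>" "0 \<le> a" and \<rho>: "\<rho> = exp (\<theta> * \<beta>) / (1 + \<theta>)"
  shows "gen_poisson_mean_tail \<beta> N a \<le> exp (\<theta> * a) * \<rho> ^ N * (1 / (\<theta> * (1 - \<beta>)) + real N)"
  using assms(4)
proof (induction N arbitrary: a)
  case 0
  have "\<theta> * a \<le> exp (\<theta> * a)"
    using exp_ge_add_one_self[of "\<theta> * a"] by linarith
  then have "\<theta> * a / (\<theta> * (1 - \<beta>)) \<le> exp (\<theta> * a) / (\<theta> * (1 - \<beta>))"
    using assms by (intro divide_right_mono) auto
  then show ?case using assms by (simp add: gen_poisson_mean_tail_def)
next
  case (Suc N)
  define C where "C = 1 / (\<theta> * (1 - \<beta>))"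
  have C: "0 \<le> C" using assms by (simp add: C_def)
  have \<rho>': "(1 + \<theta>) * \<rho> = exp (\<theta> * \<beta>)" using assms by simp
  have "0 \<le> exp (\<theta> * a) * \<rho> ^ Suc N * (C + real (Suc N)) - gen_poisson_mean_tail \<beta> (Suc N) a"
  proof (rule nonneg_if_deriv_plus_self_nonneg[OF _ _ _ Suc.prems])
    fix t :: real assume t: "0 \<le> t"
    show "((\<lambda>a. exp (\<theta> * a) * \<rho> ^ Suc N * (C + real (Suc N)) - gen_poisson_mean_tail \<beta> (Suc N) a)
       has_real_derivative
        \<theta> * exp (\<theta> * t) * \<rho> ^ Suc N * (C + real (Suc N))
          - (gen_poisson_mean_tail \<beta> N (t + \<beta>) + gen_poisson_tail \<beta> N (t + \<beta>)
              - gen_poisson_mean_tail \<beta> (Suc N) t)) (at t)"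
      by (auto intro!: derivative_eq_intros DERIV_cong[OF deriv_gen_poisson_mean_tail] assms)
    have *: "exp (\<theta> * (t + \<beta>)) * \<rho> ^ N = (1 + \<theta>) * exp (\<theta> * t) * \<rho> ^ Suc N"
    proof -
      have "exp (\<theta> * (t + \<beta>)) = exp (\<theta> * t) * ((1 + \<theta>) * \<rho>)"
        unfolding \<rho>' by (simp add: exp_add algebra_simps)
      then show ?thesis by (simp only: power_Suc mult_ac)
    qed
    have "gen_poisson_mean_tail \<beta> N (t + \<beta>) + gen_poisson_tail \<beta> N (t + \<beta>)
      \<le> exp (\<theta> * (t + \<beta>)) * \<rho> ^ N * (C + real N) + exp (\<theta> * (t + \<beta>)) * \<rho> ^ N"
      using Suc.IH[of "t + \<beta>"] gen_poisson_tail_le[OF assms(1,3) _ \<rho>, of "t + \<beta>" N] t assms(1)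
      by (simp add: C_def)
    also have "\<dots> = (1 + \<theta>) * exp (\<theta> * t) * \<rho> ^ Suc N * (C + real (Suc N))"
      unfolding * by (simp add: algebra_simps)
    finally show "0 \<le> \<theta> * exp (\<theta> * t) * \<rho> ^ Suc N * (C + real (Suc N))
          - (gen_poisson_mean_tail \<beta> N (t + \<beta>) + gen_poisson_tail \<beta> N (t + \<beta>)
              - gen_poisson_mean_tail \<beta> (Suc N) t)
        + (exp (\<theta> * t) * \<rho> ^ Suc N * (C + real (Suc N)) - gen_poisson_mean_tail \<beta> (Suc N) t)"
      by (simp add: algebra_simps)
  next
    show "0 \<le> exp (\<theta> * 0) * \<rho> ^ Suc N * (C + real (Suc N)) - gen_poisson_mean_tail \<beta> (Suc N) 0"
      using assms C by (simp add: gen_poisson_mean_tail_at_0)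
  qed
  then show ?case by (simp add: C_def)
qed

section \<open>Decay rate and convergence of the moment series\<close>

lemma exponential_rate_exists:
  fixes \<beta> :: real
  assumes "0 \<le> \<beta>" "\<beta> < 1"
  obtains \<theta> where "0 < \<theta>" "exp (\<theta> * \<beta>) / (1 + \<theta>) < 1"
proof -
  \<comment> \<open>To first order in \<theta> the logarithm of the ratio is - \<theta> (1 -
    \<beta>). This choice gives \<theta> \<beta> \<le> \<theta> < 1 - \<beta>, hence (1 + \<theta>)
    (1 - \<theta> \<beta>) = 1 + \<theta> (1 - \<beta> - \<theta> \<beta>) > 1.\<close>
  define \<theta> where "\<theta> = (1 - \<beta>) / 2"
  have \<theta>: "0 < \<theta>" using assms by (simp add: \<theta>_def)
  have "\<theta> * \<beta> \<le> \<theta> * 1" using assms \<theta> by (intro mult_left_mono) auto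
  moreover have "\<theta> < 1 - \<beta>" "\<theta> < 1" using assms by (auto simp: \<theta>_def)
  ultimately have small: "\<theta> * \<beta> < 1 - \<beta>" "\<theta> * \<beta> < 1" by linarith+
  have "\<theta> * (\<theta> * \<beta>) < \<theta> * (1 - \<beta>)" using small \<theta> by (intro mult_strict_left_mono) auto
  then have "1 < (1 + \<theta>) * (1 - \<theta> * \<beta>)" by (simp add: algebra_simps)
  also have "\<dots> \<le> (1 + \<theta>) * exp (- (\<theta> * \<beta>))"
    using exp_ge_add_one_self[of "- (\<theta> * \<beta>)"] \<theta> by (intro mult_left_mono) auto
  finally have "exp (\<theta> * \<beta>) < 1 + \<theta>" by (simp add: exp_minus field_simps)
  then show ?thesis using that[of \<theta>] \<theta> by simp
qed

lemma summable_square_times_power: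
  fixes r :: real
  assumes "0 < r" "r < 1"
  shows "summable (\<lambda>k. (real k)\<^sup>2 * r ^ k)"
proof (rule summable_comparison_test_bigo)
  \<comment> \<open>In r = s * s one factor absorbs the square, the other leaves a geometric
    majorant.\<close>
  define s where "s = sqrt r"
  have s: "0 < s" "s < 1" "r = s * s" using assms by (auto simp: s_def)
  show "summable (\<lambda>k. norm (s ^ k))"
    using s by (simp add: summable_geometric)
  have "(\<lambda>k. (real k)\<^sup>2 * s ^ k) \<in> O(\<lambda>_. 1)"
    using s by real_asymp
  from landau_o.big.mult_right[OF this, of "\<lambda>k. s ^ k"]
  show "(\<lambda>k. (real k)\<^sup>2 * r ^ k) \<in> O(\<lambda>k. s ^ k)"
    by (simp add: s(3) power_mult_distrib mult_ac)
qed

lemma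
  assumes "0 \<le> \<beta>" "\<beta> < 1" "0 \<le> a"
  shows gen_poisson_sums: "(\<lambda>k. gen_poisson \<beta> k a) sums 1"
    and gen_poisson_mean_sums: "(\<lambda>k. real k * gen_poisson \<beta> k a) sums (a / (1 - \<beta>))"
    and gen_poisson_second_moment_summable: "summable (\<lambda>k. (real k)\<^sup>2 * gen_poisson \<beta> k a)"
proof -
  obtain \<theta> where \<theta>: "0 < \<theta>" "exp (\<theta> * \<beta>) / (1 + \<theta>) < 1"
    using exponential_rate_exists[OF assms(1,2)] .
  define \<rho> where "\<rho> = exp (\<theta> * \<beta>) / (1 + \<theta>)"
  have \<rho>: "0 < \<rho>" "\<rho> < 1" using \<theta> by (auto simp: \<rho>_def add_pos_pos)
  have "(\<lambda>N. gen_poisson_tail \<beta> N a) \<longlonglongrightarrow> 0"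
  proof (rule tendsto_sandwich[OF _ _ tendsto_const])
    show "(\<lambda>N. exp (\<theta> * a) * \<rho> ^ N) \<longlonglongrightarrow> 0" using \<rho> by real_asymp
  qed (use gen_poisson_tail_nonneg gen_poisson_tail_le[OF _ _ _ \<rho>_def] assms \<theta> in auto)
  from tendsto_diff[OF tendsto_const this, of 1]
  show "(\<lambda>k. gen_poisson \<beta> k a) sums 1"
    by (simp add: sums_def gen_poisson_tail_def)
  have "(\<lambda>N. gen_poisson_mean_tail \<beta> N a) \<longlonglongrightarrow> 0"
  proof (rule tendsto_sandwich[OF _ _ tendsto_const])
    show "(\<lambda>N. exp (\<theta> * a) * \<rho> ^ N * (1 / (\<theta> * (1 - \<beta>)) + real N)) \<longlonglongrightarrow> 0"
      using \<rho> by real_asymp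
  qed (use gen_poisson_mean_tail_nonneg gen_poisson_mean_tail_le[OF _ _ _ _ \<rho>_def] assms \<theta> in auto)
  from tendsto_diff[OF tendsto_const this, of "a / (1 - \<beta>)"]
  show "(\<lambda>k. real k * gen_poisson \<beta> k a) sums (a / (1 - \<beta>))"
    by (simp add: sums_def gen_poisson_mean_tail_def)
  \<comment> \<open>A weight is the difference of two consecutive tails, and the later one is
    nonnegative.\<close>
  have le: "gen_poisson \<beta> k a \<le> exp (\<theta> * a) * \<rho> ^ k" for k
    using gen_poisson_tail_nonneg[OF assms(1,3), of "Suc k"]
      gen_poisson_tail_le[OF assms(1) \<theta>(1) assms(3) \<rho>_def, of k]
    by (simp add: gen_poisson_tail_def)
  show "summable (\<lambda>k. (real k)\<^sup>2 * gen_poisson \<beta> k a)"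
  proof (rule summable_comparison_test')
    show "summable (\<lambda>k. exp (\<theta> * a) * ((real k)\<^sup>2 * \<rho> ^ k))"
      using summable_square_times_power[OF \<rho>] by (rule summable_mult)
    show "norm ((real k)\<^sup>2 * gen_poisson \<beta> k a) \<le> exp (\<theta> * a) * ((real k)\<^sup>2 * \<rho> ^ k)" for k
      using mult_left_mono[OF le, of "(real k)\<^sup>2" k] gen_poisson_nonneg[OF assms(1,3), of k]
      by (simp add: mult_ac)
  qed
qed

section \<open>Moments of the Baskakov basis\<close>

lemma Gamma_real_plus1: "Gamma (z + 1) = z * Gamma z" if "0 < z" for z :: real
  using that by (intro Gamma_plus1) (auto dest: nonpos_Ints_nonpos)

text \<open>The Beta integral B(j + 1, s - j - 1) / c. The induction varies s because its step uses
  the exponents s and s - 1.\<close>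

lemma has_bochner_integral_baskakov:
  fixes c s :: real
  assumes "c > 0" "s > real j + 1"
  shows "has_bochner_integral lborel
    (\<lambda>t. indicator {0..} t *\<^sub>R ((c * t) ^ j / (1 + c * t) powr s))
    (fact j * Gamma (s - real j - 1) / (c * Gamma s))"
  using assms(2)
proof (induction j arbitrary: s)
  case 0
  define F where "F = (\<lambda>t. - ((1 + c * t) powr (1 - s)) / (c * (s - 1)))"
  have nn: "(\<integral>\<^sup>+t. ennreal (1 / (1 + c * t) powr s) * indicator {0..} t \<partial>lborel) = ennreal (0 - F 0)"
  proof (rule nn_integral_FTC_atLeast)
    fix t :: real assume t: "0 \<le> t"
    then have "1 + c * t > 0" using assms(1) by (simp add: add_pos_nonneg)
    then have "((\<lambda>t. (1 + c * t) powr (1 - s)) has_real_derivative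
        (1 - s) * (1 + c * t) powr (1 - s - of_nat 1) * c) (at t)"
      by (intro DERIV_fun_powr) (auto intro!: derivative_eq_intros)
    from DERIV_cdivide[OF DERIV_minus[OF this], of "c * (s - 1)"]
    have "(F has_real_derivative
        - ((1 - s) * (1 + c * t) powr (1 - s - of_nat 1) * c) / (c * (s - 1))) (at t)"
      unfolding F_def .
    also have "- ((1 - s) * (1 + c * t) powr (1 - s - of_nat 1) * c) / (c * (s - 1))
        = (1 + c * t) powr (- s)"
      using 0 assms(1) by (simp add: divide_simps) (simp add: algebra_simps)
    finally show "(F has_real_derivative 1 / (1 + c * t) powr s) (at t)"
      by (simp add: powr_minus divide_simps)
    show "0 \<le> 1 / (1 + c * t) powr s" by simp
  next
    show "(F \<longlongrightarrow> 0) at_top"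
      unfolding F_def using 0 assms(1) by real_asymp
  qed auto
  have "Gamma s = (s - 1) * Gamma (s - 1)"
    using Gamma_real_plus1[of "s - 1"] 0 by simp
  moreover have "0 < Gamma (s - 1)" using 0 by (intro Gamma_real_pos) auto
  then have "Gamma (s - 1) \<noteq> 0" by linarith
  ultimately have val: "0 - F 0 = fact 0 * Gamma (s - real 0 - 1) / (c * Gamma s)"
    using 0 assms(1) by (simp add: F_def)
  show ?case
  proof (rule has_bochner_integral_nn_integral)
    show "(\<integral>\<^sup>+t. ennreal (indicator {0..} t *\<^sub>R ((c * t) ^ 0 / (1 + c * t) powr s)) \<partial>lborel)
       = ennreal (fact 0 * Gamma (s - real 0 - 1) / (c * Gamma s))"
      unfolding val[symmetric] nn[symmetric]
      by (intro nn_integral_cong) (auto simp: indicator_def)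
    show "0 \<le> fact 0 * Gamma (s - real 0 - 1) / (c * Gamma s)"
      using 0 assms(1) by (auto intro!: divide_nonneg_nonneg mult_nonneg_nonneg Gamma_real_pos less_imp_le)
  qed auto
next
  case (Suc j)
  have s: "s - 1 > real j + 1" using Suc.prems by simp
  have G1: "Gamma s = (s - 1) * Gamma (s - 1)"
    using Gamma_real_plus1[of "s - 1"] s by simp
  have G2: "Gamma (s - real j - 1) = (s - real j - 2) * Gamma (s - real j - 2)"
    using Gamma_real_plus1[of "s - real j - 2"] s by (simp add: algebra_simps)
  have pos: "Gamma (s - 1) > 0" using s by (intro Gamma_real_pos) auto
  txt \<open>\<open>(c t)\<^sup>j\<^sup>+\<^sup>1 (1 + c t)\<^sup>-\<^sup>s = (c t)\<^sup>j (1 + c t)\<^sup>1\<^sup>-\<^sup>s - (c t)\<^sup>j (1 + c t)\<^sup>-\<^sup>s\<close>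
    replaces integration by parts.\<close>
  have "has_bochner_integral lborel
    (\<lambda>t. indicator {0..} t *\<^sub>R ((c * t) ^ j / (1 + c * t) powr (s - 1))
       - indicator {0..} t *\<^sub>R ((c * t) ^ j / (1 + c * t) powr s))
    (fact j * Gamma (s - 1 - real j - 1) / (c * Gamma (s - 1))
       - fact j * Gamma (s - real j - 1) / (c * Gamma s))"
    using s by (intro has_bochner_integral_diff Suc.IH) auto
  \<comment> \<open>With Gamma (s - j - 2) / Gamma s factored out, the bracket is (s - 1) - (s - j -
    2) = j + 1, which turns j! into (j + 1)!.\<close>
  also have "fact j * Gamma (s - 1 - real j - 1) / (c * Gamma (s - 1))
       - fact j * Gamma (s - real j - 1) / (c * Gamma s)
     = fact (Suc j) * Gamma (s - real (Suc j) - 1) / (c * Gamma s)"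
    unfolding G1 G2 using pos s assms(1)
    by (simp add: diff_diff_eq add_ac) (simp add: divide_simps; simp add: algebra_simps)
  also have "(\<lambda>t. indicator {0..} t *\<^sub>R ((c * t) ^ j / (1 + c * t) powr (s - 1))
       - indicator {0..} t *\<^sub>R ((c * t) ^ j / (1 + c * t) powr s))
     = (\<lambda>t. indicator {0..} t *\<^sub>R ((c * t) ^ Suc j / (1 + c * t) powr s))" (is "?f = ?g")
  proof
    fix t :: real
    show "?f t = ?g t"
    proof (cases "t \<ge> 0")
      case True
      then have "1 + c * t > 0" using assms(1) by (simp add: add_pos_nonneg)
      then show ?thesis using True by (simp add: powr_diff field_simps)
    qed simp
  qed
  finally show ?case .
qed


section \<open>The operators\<close>

lemma set_integral_eqI:
  "has_bochner_integral lborel (\<lambda>t. indicator S t *\<^sub>R f t) I \<Longrightarrow> (LINT t:S|lborel. f t) = I"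
  for f :: "real \<Rightarrow> real"
  unfolding set_lebesgue_integral_def by (rule has_bochner_integral_integral_eq)

locale jain_baskakov =
  fixes c \<beta> x :: real and n :: nat
  assumes c: "0 < c" and \<beta>: "0 \<le> \<beta>" "\<beta> < 1" and n: "3 * c < real n" and x: "0 \<le> x"
begin

abbreviation L :: "(real \<Rightarrow> real) \<Rightarrow> real" where
  "L f \<equiv> JB_op n c \<beta> f x"

definition weight :: "nat \<Rightarrow> real" where
  "weight k = gen_poisson \<beta> k (real n * x)"

text \<open>The prefactor is the reciprocal of the mass of the density, so this is an expectation.
  Index k stands for v = k + 1.\<close>

definition local_mean :: "(real \<Rightarrow> real) \<Rightarrow> nat \<Rightarrow> real" where
  "local_mean f k = (real n - c) / c * (LINT t:{0..}|lborel. p_basis n (Suc k) c t * f t)"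

text \<open>A domain of test functions that contains parabolas besides bounded functions: both
  \<open>mu2\<close> and the Taylor comparison apply the operator to them.\<close>

definition growth2 :: "(real \<Rightarrow> real) \<Rightarrow> real \<Rightarrow> bool" where
  "growth2 f A \<longleftrightarrow> continuous_on {0..} f \<and> (\<forall>t\<ge>0. \<bar>f t\<bar> \<le> A * (1 + t\<^sup>2))"

lemma weight_nonneg: "0 \<le> weight k"
  unfolding weight_def using \<beta> x by (intro gen_poisson_nonneg) auto

section \<open>Baskakov densities: moments and integrability\<close>

lemma p_basis_nonneg: "0 \<le> t \<Longrightarrow> 0 \<le> p_basis n (Suc k) c t"
  unfolding p_basis_def using c n
  by (intro divide_nonneg_nonneg mult_nonneg_nonneg less_imp_le[OF Gamma_real_pos])
    (auto intro!: add_pos_nonneg divide_pos_pos)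

lemma continuous_on_p_basis: "continuous_on {0..} (p_basis n (Suc k) c)"
proof -
  have "1 + c * t \<noteq> 0" if "t \<in> {0..}" for t
    using c that by (smt (verit) atLeast_iff mult_nonneg_nonneg)
  then show ?thesis
    unfolding p_basis_def using c n by (intro continuous_intros) (auto simp: Gamma_eq_zero_iff elim!: nonpos_Ints_cases)
qed

text \<open>Beta integral with j = k + i and s = n / c + k. The condition s > j + 1 becomes (i + 1)
  c < n, so the case i = 2 is exactly n > 3 c.\<close>

lemma p_basis_moment:
  assumes "real (Suc i) * c < real n"
  shows "has_bochner_integral lborel
    (\<lambda>t. indicator {0..} t *\<^sub>R (p_basis n (Suc k) c t * t ^ i))
    (fact (k + i) / fact k * (Gamma (real n / c - 1 - real i) / (c ^ i * Gamma (real n / c))))"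
proof -
  define s where "s = real n / c + real k"
  define K where "K = c * Gamma s / (fact k * Gamma (real n / c)) / c ^ i"
  have "real (Suc i) < real n / c" using assms c by (simp add: pos_less_divide_eq)
  then have s: "s > real (k + i) + 1" by (simp add: s_def)
  have s0: "0 < s" using s by simp
  have "has_bochner_integral lborel
    (\<lambda>t. K * (indicator {0..} t *\<^sub>R ((c * t) ^ (k + i) / (1 + c * t) powr s)))
    (K * (fact (k + i) * Gamma (s - real (k + i) - 1) / (c * Gamma s)))"
    by (intro has_bochner_integral_mult_right has_bochner_integral_baskakov c s)
  also have "(\<lambda>t. K * (indicator {0..} t *\<^sub>R ((c * t) ^ (k + i) / (1 + c * t) powr s)))
     = (\<lambda>t. indicator {0..} t *\<^sub>R (p_basis n (Suc k) c t * t ^ i))"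
    using c by (auto simp: fun_eq_iff K_def p_basis_def s_def Gamma_fact power_add
        power_mult_distrib add.commute)
  also have "K * (fact (k + i) * Gamma (s - real (k + i) - 1) / (c * Gamma s))
     = fact (k + i) / fact k * (Gamma (real n / c - 1 - real i) / (c ^ i * Gamma (real n / c)))"
    using c Gamma_real_pos[OF s0] by (simp add: K_def s_def field_simps)
  finally show ?thesis .
qed

lemma Gamma_ratio:
  shows "Gamma (real n / c) = (real n - c) / c * Gamma (real n / c - 1)"
    and "Gamma (real n / c - 1) = (real n - 2 * c) / c * Gamma (real n / c - 2)"
    and "Gamma (real n / c - 2) = (real n - 3 * c) / c * Gamma (real n / c - 3)"
proof -
  have 3: "3 < real n / c" using n c by (simp add: pos_less_divide_eq)
  show "Gamma (real n / c) = (real n - c) / c * Gamma (real n / c - 1)"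
    using Gamma_real_plus1[of "real n / c - 1"] 3 c by (simp add: field_simps)
  show "Gamma (real n / c - 1) = (real n - 2 * c) / c * Gamma (real n / c - 2)"
    using Gamma_real_plus1[of "real n / c - 2"] 3 c by (simp add: field_simps)
  show "Gamma (real n / c - 2) = (real n - 3 * c) / c * Gamma (real n / c - 3)"
    using Gamma_real_plus1[of "real n / c - 3"] 3 c by (simp add: field_simps)
qed

lemma Gamma_pos3: "0 < Gamma (real n / c - 3)"
  using n c by (intro Gamma_real_pos) (simp add: pos_less_divide_eq)

lemma
  shows p_basis_integral: "has_bochner_integral lborel
      (\<lambda>t. indicator {0..} t *\<^sub>R p_basis n (Suc k) c t) (c / (real n - c))"
    and p_basis_mean: "has_bochner_integral lborel
      (\<lambda>t. indicator {0..} t *\<^sub>R (p_basis n (Suc k) c t * t))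
      (c / (real n - c) * (real (Suc k) / (real n - 2 * c)))"
    and p_basis_second: "has_bochner_integral lborel
      (\<lambda>t. indicator {0..} t *\<^sub>R (p_basis n (Suc k) c t * t\<^sup>2))
      (c / (real n - c) * (real (Suc k) * real (k + 2) / ((real n - 2 * c) * (real n - 3 * c))))"
proof -
  have nz: "real n - c \<noteq> 0" "real n - 2 * c \<noteq> 0" "real n - 3 * c \<noteq> 0" "c \<noteq> 0"
    "Gamma (real n / c - 3) \<noteq> 0"
    using n c Gamma_pos3 by auto
  show "has_bochner_integral lborel
      (\<lambda>t. indicator {0..} t *\<^sub>R p_basis n (Suc k) c t) (c / (real n - c))"
    using p_basis_moment[of 0 k] n c nz by (simp add: Gamma_ratio)
  show "has_bochner_integral lborel
      (\<lambda>t. indicator {0..} t *\<^sub>R (p_basis n (Suc k) c t * t))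
      (c / (real n - c) * (real (Suc k) / (real n - 2 * c)))"
    using p_basis_moment[of 1 k] n c nz by (simp add: Gamma_ratio mult.commute)
  show "has_bochner_integral lborel
      (\<lambda>t. indicator {0..} t *\<^sub>R (p_basis n (Suc k) c t * t\<^sup>2))
      (c / (real n - c) * (real (Suc k) * real (k + 2) / ((real n - 2 * c) * (real n - 3 * c))))"
    using p_basis_moment[of 2 k] n c nz
    by (simp add: Gamma_ratio power2_eq_square numeral_2_eq_2 add.commute mult_ac)
qed

lemma p_basis_dominating:
  "has_bochner_integral lborel
      (\<lambda>t. indicator {0..} t *\<^sub>R (p_basis n (Suc k) c t * (A * (1 + t\<^sup>2))))
      (A * (c / (real n - c) *
        (1 + real (Suc k) * real (k + 2) / ((real n - 2 * c) * (real n - 3 * c)))))"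
  using has_bochner_integral_mult_right[OF
      has_bochner_integral_add[OF p_basis_integral[of k] p_basis_second[of k]], of A]
  by (simp add: algebra_simps)

lemma p_basis_integrable:
  assumes "growth2 f A"
  shows "set_integrable lborel {0..} (\<lambda>t. p_basis n (Suc k) c t * f t)"
  unfolding set_integrable_def
proof (rule Bochner_Integration.integrable_bound[OF integrable.intros[OF p_basis_dominating[of k A]]])
  have "(\<lambda>t. indicator {0..} t *\<^sub>R (p_basis n (Suc k) c t * f t)) \<in> borel_measurable borel"
    using assms unfolding growth2_def
    by (intro borel_measurable_continuous_on_indicator continuous_on_mult continuous_on_p_basis) auto
  then show "(\<lambda>t. indicator {0..} t *\<^sub>R (p_basis n (Suc k) c t * f t)) \<in> borel_measurable lborel"
    by simp
  show "AE t in lborel. norm (indicator {0..} t *\<^sub>R (p_basis n (Suc k) c t * f t))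
      \<le> norm (indicator {0..} t *\<^sub>R (p_basis n (Suc k) c t * (A * (1 + t\<^sup>2))))"
  proof (rule AE_I2)
    fix t :: real
    show "norm (indicator {0..} t *\<^sub>R (p_basis n (Suc k) c t * f t))
      \<le> norm (indicator {0..} t *\<^sub>R (p_basis n (Suc k) c t * (A * (1 + t\<^sup>2))))"
    proof (cases "0 \<le> t")
      case True
      then have "\<bar>f t\<bar> \<le> \<bar>A * (1 + t\<^sup>2)\<bar>" using assms unfolding growth2_def by (meson abs_ge_self order_trans)
      then show ?thesis by (auto simp: abs_mult intro!: mult_left_mono)
    qed simp
  qed
qed

section \<open>Local means as positive linear functionals\<close>

lemma local_mean_linear:
  assumes "growth2 f A" "growth2 g B"
  shows "local_mean (\<lambda>t. a * f t + b * g t) k = a * local_mean f k + b * local_mean g k"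
proof -
  have "(LINT t:{0..}|lborel. p_basis n (Suc k) c t * (a * f t + b * g t))
     = (LINT t:{0..}|lborel. a * (p_basis n (Suc k) c t * f t) + b * (p_basis n (Suc k) c t * g t))"
    by (simp add: algebra_simps)
  also have "\<dots> = a * (LINT t:{0..}|lborel. p_basis n (Suc k) c t * f t)
      + b * (LINT t:{0..}|lborel. p_basis n (Suc k) c t * g t)"
    using p_basis_integrable[OF assms(1)] p_basis_integrable[OF assms(2)]
    by (subst set_integral_add) auto
  finally show ?thesis unfolding local_mean_def by (simp add: algebra_simps)
qed

lemma local_mean_mono:
  assumes "growth2 f A" "growth2 g B" "\<And>t. 0 \<le> t \<Longrightarrow> f t \<le> g t"
  shows "local_mean f k \<le> local_mean g k"
  unfolding local_mean_def using c n
  by (intro mult_left_mono set_integral_mono p_basis_integrable[OF assms(1)]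
      p_basis_integrable[OF assms(2)] assms(3) p_basis_nonneg) auto

lemma local_mean_const [simp]: "local_mean (\<lambda>_. 1) k = 1"
  using c n set_integral_eqI[of "{0..}" "p_basis n (Suc k) c", OF p_basis_integral]
  by (simp add: local_mean_def)

lemma local_mean_id [simp]: "local_mean (\<lambda>t. t) k = real (Suc k) / (real n - 2 * c)"
  using c n set_integral_eqI[OF p_basis_mean] by (simp add: local_mean_def)

text \<open>Positivity traps the local mean between those of -A (1 + t^2) and A (1 + t^2), which the
  moments give explicitly.\<close>

lemma local_mean_bound:
  assumes "growth2 f A"
  shows "\<bar>local_mean f k\<bar> \<le> A * (1 + real (Suc k) * real (k + 2) / ((real n - 2 * c) * (real n - 3 * c)))"
    (is "_ \<le> ?R")
proof -
  have g: "growth2 (\<lambda>t. A * (1 + t\<^sup>2)) \<bar>A\<bar>" "growth2 (\<lambda>t. - (A * (1 + t\<^sup>2))) \<bar>A\<bar>"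
    unfolding growth2_def by (auto intro!: continuous_intros simp: abs_mult)
  have R: "local_mean (\<lambda>t. A * (1 + t\<^sup>2)) k = ?R"
    using c n set_integral_eqI[OF p_basis_dominating] by (simp add: local_mean_def)
  moreover have "local_mean (\<lambda>t. - (A * (1 + t\<^sup>2))) k = - ?R"
    using local_mean_linear[OF g(1) g(1), of "-1" 0 k] R by simp
  moreover have "local_mean f k \<le> local_mean (\<lambda>t. A * (1 + t\<^sup>2)) k"
    using assms by (intro local_mean_mono[OF assms g(1)]) (auto simp: growth2_def abs_le_iff)
  moreover have "local_mean (\<lambda>t. - (A * (1 + t\<^sup>2))) k \<le> local_mean f k"
    using assms by (intro local_mean_mono[OF g(2) assms]) (auto simp: growth2_def abs_le_iff minus_le_iff)
  ultimately show ?thesis by (auto simp: abs_le_iff)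
qed

section \<open>Moments of the weights and the series form of the operator\<close>

lemma weight_sums: "(\<lambda>k. weight (Suc k)) sums (1 - weight 0)"
  using gen_poisson_sums[OF \<beta>, of "real n * x"] x unfolding weight_def
  by (subst sums_Suc_iff) simp

lemma weight_mean_sums: "(\<lambda>k. weight (Suc k) * real (Suc k)) sums (real n * x / (1 - \<beta>))"
  using gen_poisson_mean_sums[OF \<beta>, of "real n * x"] x
    sums_Suc_iff[of "\<lambda>k. weight k * real k" "real n * x / (1 - \<beta>)"]
  by (simp add: weight_def mult.commute)

lemma weight_second_summable: "summable (\<lambda>k. weight (Suc k) * (real (Suc k))\<^sup>2)"
  using gen_poisson_second_moment_summable[OF \<beta>, of "real n * x"] x
    summable_Suc_iff[of "\<lambda>k. weight k * (real k)\<^sup>2"]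
  by (simp add: weight_def mult.commute)

text \<open>Local means grow at most quadratically in k, and (k + 1) (k + 2) = (k + 1)^2 + (k + 1),
  so weight moments up to order two dominate the series.\<close>

lemma summable_weight_local_mean:
  assumes "growth2 f A"
  shows "summable (\<lambda>k. weight (Suc k) * local_mean f k)"
proof (rule summable_comparison_test')
  define q where "q = (real n - 2 * c) * (real n - 3 * c)"
  have q: "0 < q" using n c by (simp add: q_def)
  show "summable (\<lambda>k. A * (weight (Suc k) +
      (weight (Suc k) * (real (Suc k))\<^sup>2 + weight (Suc k) * real (Suc k)) / q))"
    using sums_summable[OF weight_sums] sums_summable[OF weight_mean_sums] weight_second_summable
    by (intro summable_mult summable_add summable_divide)
  fix k
  have "norm (weight (Suc k) * local_mean f k) = weight (Suc k) * \<bar>local_mean f k\<bar>"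
    using weight_nonneg by (simp add: abs_mult)
  also have "\<dots> \<le> weight (Suc k) * (A * (1 + real (Suc k) * real (k + 2) / q))"
    unfolding q_def by (intro mult_left_mono local_mean_bound assms weight_nonneg)
  also have "\<dots> = A * (weight (Suc k) +
      (weight (Suc k) * (real (Suc k))\<^sup>2 + weight (Suc k) * real (Suc k)) / q)"
    using q by (simp add: field_simps power2_eq_square)
  finally show "norm (weight (Suc k) * local_mean f k) \<le> A * (weight (Suc k) +
      (weight (Suc k) * (real (Suc k))\<^sup>2 + weight (Suc k) * real (Suc k)) / q)" .
qed

lemma JB_op_eq:
  assumes "growth2 f A"
  shows "L f = (\<Sum>k. weight (Suc k) * local_mean f k) + weight 0 * f 0"
proof -
  define u where "u = (\<lambda>k. omega_beta \<beta> (Suc k) (real n * x) *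
      (LINT t:{0..}|lborel. p_basis n (Suc k) c t * f t))"
  have eq: "weight (Suc k) * local_mean f k = (real n - c) / c * u k" for k
    by (simp add: weight_def local_mean_def u_def gen_poisson_Suc)
  \<comment> \<open>Moving the prefactor inside the series requires convergence without it, which
    follows by cancelling a nonzero constant.\<close>
  have "(real n - c) / c \<noteq> 0" using n c by simp
  then have "summable u"
    using summable_weight_local_mean[OF assms] unfolding eq by (metis summable_cmult_iff)
  then show ?thesis
    unfolding JB_op_def eq u_def[symmetric] suminf_mult[OF \<open>summable u\<close>] by (simp add: weight_def)
qed

section \<open>Linearity and monotonicity of the operator\<close>

lemma growth2_linear:
  assumes "growth2 f A" "growth2 g B"
  shows "growth2 (\<lambda>t. a * f t + b * g t) (\<bar>a\<bar> * A + \<bar>b\<bar> * B)"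
proof -
  have "\<bar>a * f t + b * g t\<bar> \<le> (\<bar>a\<bar> * A + \<bar>b\<bar> * B) * (1 + t\<^sup>2)" if "0 \<le> t" for t
  proof -
    have "\<bar>a * f t + b * g t\<bar> \<le> \<bar>a\<bar> * \<bar>f t\<bar> + \<bar>b\<bar> * \<bar>g t\<bar>"
      by (metis abs_mult abs_triangle_ineq)
    also have "\<dots> \<le> \<bar>a\<bar> * (A * (1 + t\<^sup>2)) + \<bar>b\<bar> * (B * (1 + t\<^sup>2))"
      using assms that unfolding growth2_def by (intro add_mono mult_left_mono) auto
    finally show ?thesis by (simp add: algebra_simps)
  qed
  then show ?thesis using assms by (auto simp: growth2_def intro!: continuous_intros)
qed

lemma JB_op_linear:
  assumes "growth2 f A" "growth2 g B"
  shows "L (\<lambda>t. a * f t + b * g t) = a * L f + b * L g"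
proof -
  have "(\<Sum>k. weight (Suc k) * local_mean (\<lambda>t. a * f t + b * g t) k)
    = (\<Sum>k. a * (weight (Suc k) * local_mean f k) + b * (weight (Suc k) * local_mean g k))"
    unfolding local_mean_linear[OF assms(1,2)] by (simp add: algebra_simps)
  also have "\<dots> = a * (\<Sum>k. weight (Suc k) * local_mean f k) + b * (\<Sum>k. weight (Suc k) * local_mean g k)"
    using summable_weight_local_mean[OF assms(1)] summable_weight_local_mean[OF assms(2)]
    by (subst suminf_add[symmetric]) (auto simp: suminf_mult summable_mult)
  finally show ?thesis
    unfolding JB_op_eq[OF assms(1)] JB_op_eq[OF assms(2)] JB_op_eq[OF growth2_linear[OF assms]]
    by (simp add: algebra_simps)
qed

lemma JB_op_mono:
  assumes "growth2 f A" "growth2 g B" "\<And>t. 0 \<le> t \<Longrightarrow> f t \<le> g t"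
  shows "L f \<le> L g"
  unfolding JB_op_eq[OF assms(1)] JB_op_eq[OF assms(2)]
  by (intro add_mono suminf_le mult_left_mono local_mean_mono[OF assms] weight_nonneg assms(3)
      summable_weight_local_mean[OF assms(1)] summable_weight_local_mean[OF assms(2)]) auto

section \<open>Moments of the operator\<close>

lemma growth2_const: "growth2 (\<lambda>_. d) \<bar>d\<bar>"
proof -
  have "\<bar>d\<bar> * 1 \<le> \<bar>d\<bar> * (1 + t\<^sup>2)" for t :: real by (intro mult_left_mono) auto
  then show ?thesis by (auto simp: growth2_def intro!: continuous_intros)
qed

lemma growth2_id: "growth2 (\<lambda>t. t) 1"
proof -
  have "t \<le> 1 + t\<^sup>2" for t :: real
  proof -
    have "2 * t \<le> 1 + t\<^sup>2" using zero_le_power2[of "t - 1"] by (simp add: power2_diff)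
    moreover have "0 \<le> t\<^sup>2" by simp
    ultimately show ?thesis by linarith
  qed
  then show ?thesis by (auto simp: growth2_def intro!: continuous_intros)
qed

lemma growth2_square: "growth2 (\<lambda>t. t\<^sup>2) 1"
  by (auto simp: growth2_def intro!: continuous_intros)

lemma JB_op_const: "L (\<lambda>_. d) = d"
proof -
  have 1: "L (\<lambda>_. 1) = 1"
    unfolding JB_op_eq[OF growth2_const] using sums_unique[OF weight_sums] by simp
  show ?thesis using JB_op_linear[OF growth2_const[of 1] growth2_const[of 1], of d 0] 1 by simp
qed

text \<open>Ties the closed formula of \<open>mu1\<close> to the operator: averaging (k + 1) / (n -
  2 c) over the weights gives n x / ((1 - \<beta>) (n - 2 c)).\<close>

lemma JB_op_id: "L (\<lambda>t. t) = x + mu1 n c \<beta> x"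
proof -
  have "L (\<lambda>t. t) = (\<Sum>k. weight (Suc k) * real (Suc k) / (real n - 2 * c))"
    unfolding JB_op_eq[OF growth2_id] by simp
  also have "\<dots> = real n * x / (1 - \<beta>) / (real n - 2 * c)"
    by (intro sums_unique[symmetric] sums_divide weight_mean_sums)
  also have "\<dots> = x + mu1 n c \<beta> x"
    using c n \<beta> by (simp add: mu1_def divide_simps) (simp add: algebra_simps)
  finally show ?thesis .
qed

lemma JB_op_quadratic:
  "L (\<lambda>t. p + q * t + r * t\<^sup>2) = p + q * (x + mu1 n c \<beta> x) + r * L (\<lambda>t. t\<^sup>2)"
proof -
  \<comment> \<open>The coefficients 1 match the shape \<open>a * f t + b * g t\<close> of
    \<open>JB_op_linear\<close>.\<close>
  have g: "growth2 (\<lambda>t. 1 * p + q * t) (\<bar>1\<bar> * \<bar>p\<bar> + \<bar>q\<bar> * 1)"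
    by (intro growth2_linear growth2_const growth2_id)
  have "L (\<lambda>t. 1 * (1 * p + q * t) + r * t\<^sup>2) = 1 * L (\<lambda>t. 1 * p + q * t) + r * L (\<lambda>t. t\<^sup>2)"
    by (rule JB_op_linear[OF g growth2_square])
  also have "L (\<lambda>t. 1 * p + q * t) = 1 * L (\<lambda>_. p) + q * L (\<lambda>t. t)"
    by (rule JB_op_linear[OF growth2_const growth2_id])
  finally show ?thesis by (simp add: JB_op_const JB_op_id)
qed

lemma growth2_quadratic: "growth2 (\<lambda>t. p + q * t + r * t\<^sup>2) (\<bar>p\<bar> + \<bar>q\<bar> + \<bar>r\<bar>)"
  using growth2_linear[OF growth2_linear[OF growth2_const[of p] growth2_id, of 1 q] growth2_square, of 1 r]
  by simp

text \<open>Expands (t - x)^2 and solves for the raw second moment, so \<open>mu2\<close> enters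
  only through its definition.\<close>

lemma second_moment_eq: "L (\<lambda>t. t\<^sup>2) = mu2 n c \<beta> x - x\<^sup>2 + 2 * x * (x + mu1 n c \<beta> x)"
proof -
  have "mu2 n c \<beta> x = L (\<lambda>t. x\<^sup>2 + (- 2 * x) * t + 1 * t\<^sup>2)"
    unfolding mu2_def by (simp add: power2_diff algebra_simps)
  also have "\<dots> = x\<^sup>2 + (- 2 * x) * (x + mu1 n c \<beta> x) + 1 * L (\<lambda>t. t\<^sup>2)"
    by (rule JB_op_quadratic)
  finally show ?thesis by simp
qed

text \<open>The centre a is the mean of the functional, so the linear term vanishes and (t - a)^2
  contributes the variance.\<close>

lemma JB_op_centered_quadratic:
  fixes p d r :: real
  defines "a \<equiv> x + mu1 n c \<beta> x"
  defines "q \<equiv> (\<lambda>t. p + d * (t - a) + r * (t - a)\<^sup>2)"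
  shows "L q = p + r * (mu2 n c \<beta> x - (mu1 n c \<beta> x)\<^sup>2)"
    and "growth2 q (\<bar>p - d * a + r * a\<^sup>2\<bar> + \<bar>d - 2 * r * a\<bar> + \<bar>r\<bar>)"
proof -
  have q: "q = (\<lambda>t. (p - d * a + r * a\<^sup>2) + (d - 2 * r * a) * t + r * t\<^sup>2)"
    by (simp add: fun_eq_iff q_def power2_eq_square algebra_simps)
  show "L q = p + r * (mu2 n c \<beta> x - (mu1 n c \<beta> x)\<^sup>2)"
    unfolding q JB_op_quadratic second_moment_eq
    by (simp add: a_def power2_eq_square algebra_simps)
  show "growth2 q (\<bar>p - d * a + r * a\<^sup>2\<bar> + \<bar>d - 2 * r * a\<bar> + \<bar>r\<bar>)"
    unfolding q by (rule growth2_quadratic)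
qed

lemma mu1_nonneg: "0 \<le> mu1 n c \<beta> x"
  unfolding mu1_def using c \<beta> n x by (intro divide_nonneg_pos mult_nonneg_nonneg mult_pos_pos) auto

lemma mu1_pos: "0 < mu1 n c \<beta> x" if "0 < x"
proof -
  have "0 < real n * \<beta> + 2 * c * (1 - \<beta>)" using c \<beta> by (intro add_nonneg_pos) auto
  then show ?thesis
    unfolding mu1_def using c \<beta> n that by (intro divide_pos_pos mult_pos_pos) auto
qed

lemma mu2_nonneg: "0 \<le> mu2 n c \<beta> x"
proof -
  have "L (\<lambda>_. 0) \<le> L (\<lambda>t. x\<^sup>2 + (- 2 * x) * t + 1 * t\<^sup>2)"
  proof (rule JB_op_mono[OF growth2_const growth2_quadratic])
    show "0 \<le> x\<^sup>2 + (- 2 * x) * t + 1 * t\<^sup>2" for t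
      using zero_le_power2[of "t - x"] by (simp add: power2_diff algebra_simps)
  qed
  then show ?thesis unfolding mu2_def by (simp add: JB_op_const power2_diff algebra_simps)
qed

text \<open>Here g lies between two parabolas that meet at a with common slope d. Since a is the
  mean, d drops out.\<close>

lemma JB_op_smooth_bound:
  assumes "growth2 g A" and
    bound: "\<And>t. 0 \<le> t \<Longrightarrow> \<bar>g t - g (x + mu1 n c \<beta> x) - d * (t - (x + mu1 n c \<beta> x))\<bar>
      \<le> r * (t - (x + mu1 n c \<beta> x))\<^sup>2"
  shows "\<bar>L g - g (x + mu1 n c \<beta> x)\<bar> \<le> r * (mu2 n c \<beta> x - (mu1 n c \<beta> x)\<^sup>2)"
proof -
  define a where "a = x + mu1 n c \<beta> x"
  have b: "g a + d * (t - a) + (- r) * (t - a)\<^sup>2 \<le> g t" "g t \<le> g a + d * (t - a) + r * (t - a)\<^sup>2"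
    if "0 \<le> t" for t
    using bound[OF that] by (auto simp: a_def abs_le_iff)
  have "L g \<le> g a + r * (mu2 n c \<beta> x - (mu1 n c \<beta> x)\<^sup>2)"
    using JB_op_mono[OF assms(1) JB_op_centered_quadratic(2)[of "g a" d r]] b(2)
    unfolding JB_op_centered_quadratic(1) a_def by blast
  moreover have "g a + (- r) * (mu2 n c \<beta> x - (mu1 n c \<beta> x)\<^sup>2) \<le> L g"
    using JB_op_mono[OF JB_op_centered_quadratic(2)[of "g a" d "- r"] assms(1)] b(1)
    unfolding JB_op_centered_quadratic(1) a_def by blast
  ultimately show ?thesis by (simp add: a_def abs_le_iff)
qed

end

section \<open>Smoothing by Steklov means\<close>

text \<open>Lagrange remainder of order two. The intermediate point stays in the interval S, so u''
  may be unbounded elsewhere.\<close>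

lemma taylor2_bound:
  fixes u u' u'' :: "real \<Rightarrow> real"
  assumes "\<And>t. (u has_real_derivative u' t) (at t)" "\<And>t. (u' has_real_derivative u'' t) (at t)"
    and S: "is_interval S" "a \<in> S" "y \<in> S" and bound: "\<And>t. t \<in> S \<Longrightarrow> \<bar>u'' t\<bar> \<le> B"
  shows "\<bar>u y - u a - u' a * (y - a)\<bar> \<le> B / 2 * (y - a)\<^sup>2"
proof (cases "y = a")
  case False
  define D where "D = (\<lambda>m. if m = 0 then u else if m = Suc 0 then u' else u'')"
  have "\<exists>t. (if y < a then y < t \<and> t < a else a < t \<and> t < y) \<and>
    u y = (\<Sum>m<2. (D m a / fact m) * (y - a) ^ m) + (D 2 t / fact 2) * (y - a) ^ 2"
    using False assms(1,2)
    by (intro Taylor[where a = "min a y" and b = "max a y"]) (auto simp: D_def less_2_cases_iff)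
  then obtain t where t: "if y < a then y < t \<and> t < a else a < t \<and> t < y"
    and eq: "u y = (\<Sum>m<2. (D m a / fact m) * (y - a) ^ m) + (D 2 t / fact 2) * (y - a) ^ 2"
    by blast
  have "t \<in> S"
    using t S by (auto intro: mem_is_interval_1_I[of S y a] mem_is_interval_1_I[of S a y] split: if_splits)
  from bound[OF this] have "\<bar>u'' t / 2 * (y - a)\<^sup>2\<bar> \<le> B / 2 * (y - a)\<^sup>2"
    by (simp add: abs_mult mult_right_mono)
  moreover have "u y - u a - u' a * (y - a) = u'' t / 2 * (y - a)\<^sup>2"
    unfolding eq by (simp add: D_def numeral_2_eq_2)
  ultimately show ?thesis by (simp only:)
qed simp

text \<open>Expansion about the midpoint h: the linear terms cancel and each remainder contributes B
  / 2 * h^2.\<close>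

lemma second_difference_bound:
  fixes u u' u'' :: "real \<Rightarrow> real"
  assumes "\<And>t. (u has_real_derivative u' t) (at t)" "\<And>t. (u' has_real_derivative u'' t) (at t)"
    and "0 \<le> h" and bound: "\<And>t. 0 \<le> t \<Longrightarrow> t \<le> 2 * h \<Longrightarrow> \<bar>u'' t\<bar> \<le> B"
  shows "\<bar>u (2 * h) - 2 * u h + u 0\<bar> \<le> B * h\<^sup>2"
proof -
  have "\<bar>u y - u h - u' h * (y - h)\<bar> \<le> B / 2 * (y - h)\<^sup>2" if "y \<in> {0..2 * h}" for y
    using assms that by (intro taylor2_bound[where S = "{0..2 * h}" and u'' = u'']) (auto simp: is_interval_cc)
  from this[of "2 * h"] this[of 0] \<open>0 \<le> h\<close>
  have "\<bar>u (2 * h) - u h - u' h * h\<bar> \<le> B / 2 * h\<^sup>2" "\<bar>u 0 - u h + u' h * h\<bar> \<le> B / 2 * h\<^sup>2"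
    by simp_all
  then show ?thesis by linarith
qed

lemma antiderivative_exists:
  fixes f :: "real \<Rightarrow> real"
  assumes "continuous_on UNIV f"
  obtains F where "\<And>t. (F has_real_derivative f t) (at t)"
  using einterval_antiderivative[of "-\<infinity>" "\<infinity>" f] assms
  by (auto simp: continuous_on_eq_continuous_at has_real_derivative_iff_has_vector_derivative)

lemma steklov_approximation:
  fixes f :: "real \<Rightarrow> real"
  assumes cont: "continuous_on {0..} f" and "0 < \<delta>"
    and W: "\<And>y h. 0 \<le> y \<Longrightarrow> 0 < h \<Longrightarrow> h \<le> \<delta> \<Longrightarrow> \<bar>f (y + 2 * h) - 2 * f (y + h) + f y\<bar> \<le> W"
  obtains g g' g'' where "\<And>t. (g has_real_derivative g' t) (at t)"
    "\<And>t. (g' has_real_derivative g'' t) (at t)"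
    "\<And>t. 0 \<le> t \<Longrightarrow> \<bar>f t - g t\<bar> \<le> W" "\<And>t. 0 \<le> t \<Longrightarrow> \<bar>g'' t\<bar> \<le> 9 * W / \<delta>\<^sup>2"
proof -
  \<comment> \<open>Extension by the constant f 0 gives antiderivatives on the whole line with
    two-sided derivatives. For t \<ge> 0 the mean uses only values to the right of t, where the
    extension agrees with f.\<close>
  define fe where "fe = (\<lambda>t. f (max 0 t))"
  have "continuous_on UNIV fe"
    unfolding fe_def by (intro continuous_on_compose2[OF cont] continuous_intros) auto
  then obtain F where F: "\<And>t. (F has_real_derivative fe t) (at t)"
    using antiderivative_exists by blast
  have "continuous_on UNIV F"
    using F by (meson DERIV_isCont continuous_at_imp_continuous_on)
  then obtain G where G: "\<And>t. (G has_real_derivative F t) (at t)"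
    using antiderivative_exists by blast
  have affine: "((\<lambda>t. a + b * t) has_real_derivative b) (at t)" for a b t :: real
    by (auto intro!: derivative_eq_intros)
  have F2: "((\<lambda>t. F (a + 2 * t)) has_real_derivative 2 * fe (a + 2 * t)) (at t)" for a t
    by (rule DERIV_cong[OF DERIV_chain2[OF F affine]]) simp
  have F1: "((\<lambda>t. F (a + t)) has_real_derivative fe (a + t)) (at t)" for a t
    using DERIV_chain2[OF F affine[of a 1]] by simp
  have G2: "((\<lambda>t. G (a + 2 * t)) has_real_derivative 2 * F (a + 2 * t)) (at t)" for a t
    by (rule DERIV_cong[OF DERIV_chain2[OF G affine]]) simp
  have G1: "((\<lambda>t. G (a + t)) has_real_derivative F (a + t)) (at t)" for a t
    using DERIV_chain2[OF G affine[of a 1]] by simp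
  \<comment> \<open>Every second difference of f below has step at most 2 \<eta> = \<delta>, the
    range that W controls.\<close>
  define \<eta> where "\<eta> = \<delta> / 2"
  have \<eta>: "0 < \<eta>" "2 * \<eta> = \<delta>" using \<open>0 < \<delta>\<close> by (auto simp: \<eta>_def)
  have "0 \<le> W" using W[of 0 \<delta>] \<open>0 < \<delta>\<close> by simp
  txt \<open>\<open>S G\<close> is the Steklov mean of \<open>f\<close>: second differences of the second antiderivative \<open>G\<close>
    are double integrals of \<open>f\<close>.\<close>
  define S where "S = (\<lambda>\<Phi> t. (2 * (\<Phi> (2 * \<eta> + t) - 2 * \<Phi> (\<eta> + t) + \<Phi> t)
      - (\<Phi> (4 * \<eta> + t) - 2 * \<Phi> (2 * \<eta> + t) + \<Phi> t) / 4) / \<eta>\<^sup>2 :: real)"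
  show ?thesis
  proof (rule that[of "S G" "S F" "S fe"])
    show "(S G has_real_derivative S F t) (at t)" for t
      unfolding S_def
      by (rule DERIV_cdivide) (auto intro!: derivative_eq_intros G G1)
    show "(S F has_real_derivative S fe t) (at t)" for t
      unfolding S_def
      by (rule DERIV_cdivide) (auto intro!: derivative_eq_intros F F1)
  next
    fix t :: real assume t: "0 \<le> t"
    define D1 where "D1 = f (t + 2 * \<eta>) - 2 * f (t + \<eta>) + f t"
    define D2 where "D2 = f (t + 2 * (2 * \<eta>)) - 2 * f (t + 2 * \<eta>) + f t"
    have D: "\<bar>D1\<bar> \<le> W" "\<bar>D2\<bar> \<le> W"
      unfolding D1_def D2_def using W[OF t, of \<eta>] W[OF t, of "2 * \<eta>"] \<eta> by auto
    \<comment> \<open>Here 9 / 4 = 2 + 1 / 4, and \<eta> = \<delta> / 2 turns it into the 9 of the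
      claim.\<close>
    have "\<bar>2 * D1 - D2 / 4\<bar> \<le> 9 / 4 * W" using D by linarith
    then have "\<bar>2 * D1 - D2 / 4\<bar> / \<eta>\<^sup>2 \<le> 9 / 4 * W / \<eta>\<^sup>2" by (intro divide_right_mono) auto
    moreover have "S fe t = (2 * D1 - D2 / 4) / \<eta>\<^sup>2"
      using t \<eta>(1) by (simp add: S_def fe_def D1_def D2_def max_def add.commute)
    ultimately have "\<bar>S fe t\<bar> \<le> 9 / 4 * W / \<eta>\<^sup>2" by (simp add: abs_divide)
    then show "\<bar>S fe t\<bar> \<le> 9 * W / \<delta>\<^sup>2"
      by (simp add: \<eta>_def power_divide)
    \<comment> \<open>The second derivative of \<phi> in s is minus the second difference of f at t
      with step s, while the second difference of \<phi> with step \<eta> is \<eta>^2 times the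
      approximation error.\<close>
    define \<phi> where "\<phi> = (\<lambda>s. 2 * G (t + s) - G (t + 2 * s) / 4 - s\<^sup>2 / 2 * f t)"
    have "\<bar>\<phi> (2 * \<eta>) - 2 * \<phi> \<eta> + \<phi> 0\<bar> \<le> W * \<eta>\<^sup>2"
    proof (rule second_difference_bound)
      show "(\<phi> has_real_derivative 2 * F (t + s) - F (t + 2 * s) / 2 - s * f t) (at s)" for s
        unfolding \<phi>_def by (auto intro!: derivative_eq_intros G1 G2)
      show "((\<lambda>s. 2 * F (t + s) - F (t + 2 * s) / 2 - s * f t) has_real_derivative
          2 * fe (t + s) - fe (t + 2 * s) - f t) (at s)" for s
        by (auto intro!: derivative_eq_intros F1 F2)
      fix s :: real assume s: "0 \<le> s" "s \<le> 2 * \<eta>"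
      \<comment> \<open>Step 0 lies outside the hypothesis on W, but there the difference
        vanishes.\<close>
      have "\<bar>f (t + 2 * s) - 2 * f (t + s) + f t\<bar> \<le> W"
        using W[OF t, of s] s \<eta> \<open>0 \<le> W\<close> by (cases "s = 0") auto
      then show "\<bar>2 * fe (t + s) - fe (t + 2 * s) - f t\<bar> \<le> W"
        using s t by (simp add: fe_def max_def abs_le_iff)
    qed (use \<eta> in simp)
    moreover have "\<phi> (2 * \<eta>) - 2 * \<phi> \<eta> + \<phi> 0 = (S G t - f t) * \<eta>\<^sup>2"
      using \<eta>(1) by (simp add: \<phi>_def S_def field_simps power2_eq_square)
    ultimately show "\<bar>f t - S G t\<bar> \<le> W"
      using \<eta> by (simp add: abs_mult abs_minus_commute)
  qed
qed

section \<open>The estimate\<close>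

lemma CB_bounded:
  assumes "f \<in> CB"
  obtains A where "\<And>t. 0 \<le> t \<Longrightarrow> \<bar>f t\<bar> \<le> A"
  using assms unfolding CB_def bounded_iff by auto

text \<open>A real \<open>Sup\<close> is an upper bound only for sets bounded above, which is where
  boundedness of f enters.\<close>

lemma modcont_ge:
  assumes "f \<in> CB" "0 \<le> x" "0 \<le> t" "\<bar>t - x\<bar> \<le> \<delta>"
  shows "\<bar>f t - f x\<bar> \<le> modcont f \<delta>"
  unfolding modcont_def
proof (rule cSup_upper)
  obtain A where A: "\<And>t. 0 \<le> t \<Longrightarrow> \<bar>f t\<bar> \<le> A" using CB_bounded[OF assms(1)] by blast
  have "\<bar>f t - f x\<bar> \<le> 2 * A" if "0 \<le> x" "0 \<le> t" for x t
    using A[OF that(1)] A[OF that(2)] by linarith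
  moreover have "0 \<le> A" using A[of 0] by linarith
  ultimately show "bdd_above (insert 0 {\<bar>f t - f x\<bar> |x t. 0 \<le> x \<and> 0 \<le> t \<and> \<bar>t - x\<bar> \<le> \<delta>})"
    by (auto intro!: bdd_aboveI[of _ "2 * A"])
qed (use assms in auto)

lemma bdd_above_modsmooth2:
  assumes "f \<in> CB"
  shows "bdd_above (insert 0 {\<bar>f (x + 2 * h) - 2 * f (x + h) + f x\<bar> |x h. 0 < h \<and> h \<le> \<delta> \<and> 0 \<le> x})"
proof -
  obtain A where A: "\<And>t. 0 \<le> t \<Longrightarrow> \<bar>f t\<bar> \<le> A" using CB_bounded[OF assms] by blast
  have "\<bar>f (x + 2 * h) - 2 * f (x + h) + f x\<bar> \<le> 4 * A" if "0 \<le> x" "0 < h" for x h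
    using A[of x] A[of "x + h"] A[of "x + 2 * h"] that by (simp add: abs_le_iff)
  moreover have "0 \<le> A" using A[of 0] by linarith
  ultimately show ?thesis by (auto intro!: bdd_aboveI[of _ "4 * A"])
qed

lemma modsmooth2_ge:
  assumes "f \<in> CB" "0 \<le> x" "0 < h" "h \<le> \<delta>"
  shows "\<bar>f (x + 2 * h) - 2 * f (x + h) + f x\<bar> \<le> modsmooth2 f \<delta>"
  unfolding modsmooth2_def
  by (rule cSup_upper[OF _ bdd_above_modsmooth2[OF assms(1)]]) (use assms in auto)

lemma modsmooth2_nonneg: "f \<in> CB \<Longrightarrow> 0 \<le> modsmooth2 f \<delta>"
  unfolding modsmooth2_def by (rule cSup_upper[OF _ bdd_above_modsmooth2]) auto

context jain_baskakov
begin

lemma growth2_bounded: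
  assumes "continuous_on {0..} f" "\<And>t. 0 \<le> t \<Longrightarrow> \<bar>f t\<bar> \<le> A"
  shows "growth2 f A"
proof -
  have "0 \<le> A" using assms(2)[of 0] by linarith
  then have "A * 1 \<le> A * (1 + t\<^sup>2)" for t by (intro mult_left_mono) auto
  then show ?thesis
    unfolding growth2_def using assms by (metis mult_1_right order_trans)
qed

lemma JB_op_estimate:
  assumes f: "f \<in> CB"
  shows "\<bar>L f - f x\<bar> \<le> modcont f (mu1 n c \<beta> x)
    + 13 / 2 * modsmooth2 f (sqrt ((mu1 n c \<beta> x)\<^sup>2 + mu2 n c \<beta> x))"
\<comment> \<open>At x = 0 the scale \<delta> is 0 and admits no Steklov step, but all terms of the
  series vanish and L f = f 0.\<close>
proof (cases "x = 0")
  case True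
  have "L f = f 0"
    unfolding JB_op_def True by (simp add: omega_beta_def)
  moreover have "0 \<le> modcont f (mu1 n c \<beta> x)"
    using modcont_ge[OF f, of 0 0 "mu1 n c \<beta> x"] mu1_nonneg by simp
  ultimately show ?thesis using modsmooth2_nonneg[OF f] True by simp
next
  case False
  define \<delta> where "\<delta> = sqrt ((mu1 n c \<beta> x)\<^sup>2 + mu2 n c \<beta> x)"
  define W where "W = modsmooth2 f \<delta>"
  define a where "a = x + mu1 n c \<beta> x"
  have m1: "0 < mu1 n c \<beta> x" using mu1_pos False x by simp
  have \<delta>2: "\<delta>\<^sup>2 = (mu1 n c \<beta> x)\<^sup>2 + mu2 n c \<beta> x"
    unfolding \<delta>_def using mu2_nonneg by simp
  have "0 < \<delta>"
    unfolding \<delta>_def using m1 mu2_nonneg by (simp add: add_pos_nonneg)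
  have "0 \<le> W" using modsmooth2_nonneg[OF f] by (simp add: W_def)
  have "0 \<le> a" using x m1 by (simp add: a_def)
  have contf: "continuous_on {0..} f" using f by (simp add: CB_def)
  obtain g g' g'' where g: "\<And>t. (g has_real_derivative g' t) (at t)"
    "\<And>t. (g' has_real_derivative g'' t) (at t)"
    and fg: "\<And>t. 0 \<le> t \<Longrightarrow> \<bar>f t - g t\<bar> \<le> W" and g2: "\<And>t. 0 \<le> t \<Longrightarrow> \<bar>g'' t\<bar> \<le> 9 * W / \<delta>\<^sup>2"
    using steklov_approximation[OF contf \<open>0 < \<delta>\<close>, of W] modsmooth2_ge[OF f] unfolding W_def by metis
  obtain A where A: "\<And>t. 0 \<le> t \<Longrightarrow> \<bar>f t\<bar> \<le> A" using CB_bounded[OF f] by blast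
  have contg: "continuous_on {0..} g"
    using g(1) by (meson DERIV_isCont continuous_at_imp_continuous_on)
  have gf: "growth2 f A" by (rule growth2_bounded[OF contf A])
  have gg: "growth2 g (A + W)"
    by (rule growth2_bounded[OF contg]) (use A fg in \<open>smt (verit)\<close>)
  have "\<bar>L f - L g\<bar> \<le> W"
  proof -
    have fg': "- W \<le> 1 * f t + (- 1) * g t" "1 * f t + (- 1) * g t \<le> W" if "0 \<le> t" for t
      using fg[OF that] by linarith+
    have gd: "growth2 (\<lambda>t. 1 * f t + (- 1) * g t) (\<bar>1\<bar> * A + \<bar>- 1\<bar> * (A + W))"
      by (rule growth2_linear[OF gf gg])
    have "L (\<lambda>t. 1 * f t + (- 1) * g t) \<le> W"
      using JB_op_mono[OF gd growth2_const fg'(2)] by (simp add: JB_op_const)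
    moreover have "- W \<le> L (\<lambda>t. 1 * f t + (- 1) * g t)"
      using JB_op_mono[OF growth2_const gd fg'(1)] by (simp add: JB_op_const)
    ultimately show ?thesis
      unfolding JB_op_linear[OF gf gg] by (simp add: abs_le_iff)
  qed
  moreover have "\<bar>L g - g a\<bar> \<le> 9 / 2 * W"
  proof -
    have "\<bar>g t - g a - g' a * (t - a)\<bar> \<le> 9 * W / \<delta>\<^sup>2 / 2 * (t - a)\<^sup>2" if "0 \<le> t" for t
      using g g2 that \<open>0 \<le> a\<close> by (intro taylor2_bound[where S = "{0..}"]) (auto simp: is_interval_ci)
    then have "\<bar>L g - g a\<bar> \<le> 9 * W / \<delta>\<^sup>2 / 2 * (mu2 n c \<beta> x - (mu1 n c \<beta> x)\<^sup>2)"
      unfolding a_def by (rule JB_op_smooth_bound[OF gg])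
    \<comment> \<open>The variance mu2 - mu1^2 is at most mu2 + mu1^2 = \<delta>^2, which cancels
      the scale in the bound on g''.\<close>
    also have "\<dots> \<le> 9 * W / \<delta>\<^sup>2 / 2 * \<delta>\<^sup>2"
      unfolding \<delta>2 using \<open>0 \<le> W\<close> mu2_nonneg by (intro mult_left_mono) auto
    finally show ?thesis using \<open>0 < \<delta>\<close> by simp
  qed
  moreover have "\<bar>f a - g a\<bar> \<le> W" using fg \<open>0 \<le> a\<close> .
  moreover have "\<bar>f a - f x\<bar> \<le> modcont f (mu1 n c \<beta> x)"
    using modcont_ge[OF f x \<open>0 \<le> a\<close>] m1 by (simp add: a_def)
  \<comment> \<open>The three multiples of W add up to 1 + 9 / 2 + 1 = 13 / 2.\<close>
  ultimately show ?thesis unfolding W_def \<delta>_def by linarith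
qed

end

theorem theorem1:
  shows "\<exists>M>0. \<forall>(c::real) (\<beta>::real) (n::nat) f (x::real).
     c > 0 \<longrightarrow> 0 \<le> \<beta> \<longrightarrow> \<beta> < 1 \<longrightarrow> real n > 3 * c \<longrightarrow> f \<in> CB \<longrightarrow> x \<ge> 0 \<longrightarrow>
     \<bar>JB_op n c \<beta> f x - f x\<bar> \<le> modcont f (mu1 n c \<beta> x)
        + M * modsmooth2 f (sqrt ((mu1 n c \<beta> x)\<^sup>2 + mu2 n c \<beta> x))"
proof (intro exI[of _ "13 / 2"] conjI allI impI)
  fix c \<beta> :: real and n :: nat and f :: "real \<Rightarrow> real" and x :: real
  assume "c > 0" "0 \<le> \<beta>" "\<beta> < 1" "real n > 3 * c" "f \<in> CB" "x \<ge> 0"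
  then interpret jain_baskakov c \<beta> x n by unfold_locales
  show "\<bar>JB_op n c \<beta> f x - f x\<bar> \<le> modcont f (mu1 n c \<beta> x)
        + 13 / 2 * modsmooth2 f (sqrt ((mu1 n c \<beta> x)\<^sup>2 + mu2 n c \<beta> x))"
    using JB_op_estimate \<open>f \<in> CB\<close> .
qed simp

end
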